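(* Fix integers $n\ge 1$, $k\ge 0$ and let $\mathcal S=\{0,1,\dots,k\}$. Define, for $i\in\{1,\dots,n\}$ and $s\in\mathcal S$, $$a(i,s)=\frac{1}{k+1}\prod_{t=1}^{n-1}\frac{s+t}{k+t+1},$$ and for $j>i$, $s,s'\in\mathcal S$, $c(j,s',i,s)=\frac{1}{s'+1}\prod_{t=1}^{i-1}\frac{s+t}{s'+t+1}$ if $s'\ge s$ and $c(j,s',i,s)=0$ otherwise. Let $u$ be defined by backward recursion: $u(n,s)=a(n,s)$ and for $i<n$, $$u(i,s)=\max\Big\{0,\ a(i,s)-\sum_{j>i}\sum_{s'\ge s}u(j,s')\,c(j,s',i,s)\Big\}.$$ Then $u(n,s)=\frac{1}{k+1}\prod_{t=1}^{n-1}\frac{s+t}{k+t+1}$ for all $s$, and for $i<n$ and all $s$, $$u(i,s)=\max\Bigg\{0,\ \frac{1}{k+1}\prod_{t=1}^{i-1}\frac{s+t}{k+t+1}\cdot\Bigg(\prod_{t=i}^{n-1}\frac{s+t}{k+t+1}-\frac{\sum_{j=1}^{n-i}\binom{n-i}{j}\frac{1}{j}\prod_{\ell=1}^{j}(k-s+\ell)\prod_{\ell=1}^{n-i-j}(s+i-1+\ell)}{\prod_{t=i}^{n-1}(k+t+1)}\Bigg)\Bigg\},$$ with the convention that $\prod_{t=a}^{b}x_t=1$ when $b<a$.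
   Context: This recursion is the greedy (backward induction) solution of the dual LP $\min\sum_{i,s}u(i,s)$ s.t. $u(i,s)+\sum_{j>i}\sum_{s'\ge s}u(j,s')c(j,s',i,s)\ge a(i,s)$, $u\ge 0$, associated with the secretary problem with $k$ samples and $n$ secretaries, where $s$ is the number of samples below the current secretary. *)

theory Defs
  imports Complex_Main
begin

text \<open>
  Secretary problem with \<open>k\<close> samples and \<open>n\<close> secretaries: \<open>i\<close> and \<open>j\<close> are positions in \<open>{1..n}\<close>,
  \<open>s\<close> and \<open>s'\<close> are numbers of samples in \<open>{0..k}\<close>. The values outside these ranges have no
  meaning.
\<close>

text \<open>The coefficient does not depend on the position \<open>i\<close>.\<close>

definition dual_a :: "nat \<Rightarrow> nat \<Rightarrow> nat \<Rightarrow> nat \<Rightarrow> real" where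
  "dual_a n k i s = 1 / (real k + 1) * (\<Prod>t = 1..n - 1. (real s + real t) / (real k + real t + 1))"

text \<open>The coefficient is meant for \<open>j > i\<close> and does not depend on \<open>j\<close> otherwise.\<close>

definition dual_c :: "nat \<Rightarrow> nat \<Rightarrow> nat \<Rightarrow> nat \<Rightarrow> real" where
  "dual_c j s' i s =
    (if s' \<ge> s
     then 1 / (real s' + 1) * (\<Prod>t = 1..i - 1. (real s + real t) / (real s' + real t + 1))
     else 0)"

text \<open>
  Backward recursion on the position, starting at \<open>i = n\<close>; the \<open>else\<close> branch is also taken for
  the meaningless positions \<open>i > n\<close>, which the recursion never reaches.
\<close>

function dual_u :: "nat \<Rightarrow> nat \<Rightarrow> nat \<Rightarrow> nat \<Rightarrow> real" where
  "dual_u n k i s =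
    (if i < n
     then max 0 (dual_a n k i s - (\<Sum>j\<in>{i<..n}. \<Sum>s'\<in>{s..k}. dual_u n k j s' * dual_c j s' i s))
     else dual_a n k i s)"
  by pat_completeness auto
termination
  by (relation "measure (\<lambda>(n, k, i, s). n - i)") auto

text \<open>The equation is unconditional, so it loops as a simplification rule.\<close>

declare dual_u.simps [simp del]

end

theory Submission
  imports Defs
begin

text \<open>
  Every quantity is a ratio of rising factorials. Dropping the \<open>max\<close> from the recursion gives a
  linear one, solved by the closed form \<open>u_cand\<close>: in the summation over \<open>j\<close> the binomial
  coefficients add up by the hockey-stick identity, and the summation over \<open>s'\<close> then telescopes.
  To reinstate the \<open>max\<close>, note that \<open>u_cand n k i s\<close> is a positive multiple of \<open>1 - h\<close> with \<open>h\<close>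
  decreasing in both \<open>i\<close> and \<open>s\<close>. So where \<open>u_cand\<close> is positive, no truncation occurs in the
  terms that it depends on. Everywhere else, truncation only enlarges the subtracted sum, and
  the maximum stays 0.
\<close>

section \<open>Shift identities for binomial sums of rising factorials\<close>

definition corr :: "nat \<Rightarrow> real \<Rightarrow> real \<Rightarrow> real" where
  "corr m x y = (\<Sum>l = 1..m. real (m choose l) / real l * pochhammer x l * pochhammer y (m - l))"

text \<open>At \<open>m = n - i\<close>, \<open>x = k - s + 1\<close>, \<open>y = s + i\<close>,
  \<open>corr\<close> is the numerator of the fraction in the theorem, and \<open>gap\<close> is the
  whole bracket after clearing its common denominator. Real arguments allow both to be shifted by
  one.\<close>

definition gap :: "nat \<Rightarrow> real \<Rightarrow> real \<Rightarrow> real" where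
  "gap m x y = pochhammer y m - corr m x y"

text \<open>Insert the mixed term \<open>pochhammer (x + 1) l * pochhammer (y + 1) (m - l)\<close>
  and use twice that raising the base of a rising factorial of length \<open>q\<close> by one
  changes it by \<open>q\<close> times the factorial of length \<open>q - 1\<close> at the raised
  base.\<close>

lemma pochhammer_exchange_diff:
  fixes x y :: "'a::comm_ring_1"
  assumes "1 \<le> l" "l \<le> m"
  shows "pochhammer (x + 1) l * pochhammer y (m - l) - pochhammer x l * pochhammer (y + 1) (m - l)
    = of_nat l * pochhammer (x + 1) (l - 1) * pochhammer (y + 1) (m - l)
      - of_nat (m - l) * pochhammer (x + 1) l * pochhammer (y + 1) (m - l - 1)"
proof -
  obtain p where l: "l = Suc p" using assms by (cases l) auto
  obtain q where m: "m = Suc p + q" using assms l le_Suc_ex by blast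
  have x: "pochhammer x l = x * pochhammer (x + 1) p"
    "pochhammer (x + 1) l = pochhammer (x + 1) p * (x + 1 + of_nat p)"
    unfolding l by (rule pochhammer_rec, rule pochhammer_Suc)
  show ?thesis
  \<comment> \<open>For \<open>q = 0\<close> the coefficient \<open>m - l\<close> vanishes, so the
    truncated length \<open>m - l - 1\<close> does no harm.\<close>
  proof (cases q)
    case 0
    then have lengths: "m - l = 0" "l - 1 = p" by (simp_all add: l m)
    show ?thesis
      unfolding x lengths by (simp add: l ring_distribs mult.commute)
  next
    case (Suc r)
    then have lengths: "m - l = Suc r" "m - l - 1 = r" "l - 1 = p" by (simp_all add: l m)
    have y: "pochhammer y (Suc r) = y * pochhammer (y + 1) r"
      "pochhammer (y + 1) (Suc r) = pochhammer (y + 1) r * (y + 1 + of_nat r)"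
      by (rule pochhammer_rec, rule pochhammer_Suc)
    show ?thesis
      unfolding x lengths y by (simp add: l algebra_simps)
  qed
qed

text \<open>Absorption gives the factor \<open>(l + 1) / l = 1 + 1 / l\<close>; the part belonging
  to \<open>1\<close> is the one that cancels in \<open>corr_diff\<close>.\<close>

lemma binomial_divide_Suc:
  assumes "1 \<le> l"
  shows "real (m choose l) * real (m - l) / real l
    = real (m choose Suc l) + real (m choose Suc l) / real l"
proof -
  have "(m - l) * (m choose l) = Suc l * (m choose Suc l)"
    by (simp only: binomial_absorb_comp binomial_absorption)
  then have "real (m choose l) * real (m - l) = (real l + 1) * real (m choose Suc l)"
    by (simp add: algebra_simps flip: of_nat_mult of_nat_Suc of_nat_add)
  then show ?thesis using assms by (simp add: add_divide_distrib distrib_right)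
qed

text \<open>The exchange identity turns each summand into a difference of neighbouring terms
  \<open>?T (l - 1)\<close> and \<open>?T l\<close>. After an index shift, the summands with plain
  binomial coefficients cancel except the one at \<open>l = 0\<close>; only the part with
  \<open>1 / l\<close> survives.\<close>

lemma corr_diff:
  "corr m (x + 1) y - corr m x (y + 1)
    = real m * pochhammer (y + 1) (m - 1)
      - (\<Sum>l = 1..<m. real (m choose Suc l) / real l
           * pochhammer (x + 1) l * pochhammer (y + 1) (m - Suc l))"
proof (cases m)
  case 0
  then show ?thesis by (simp add: corr_def)
next
  case (Suc p)
  let ?T = "\<lambda>l. pochhammer (x + 1) l * pochhammer (y + 1) (m - Suc l)"
  have "corr m (x + 1) y - corr m x (y + 1)
    = (\<Sum>l = 1..m. real (m choose l) / real l *
        (pochhammer (x + 1) l * pochhammer y (m - l) - pochhammer x l * pochhammer (y + 1) (m - l)))"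
    by (simp add: corr_def sum_subtractf algebra_simps)
  also have "\<dots> = (\<Sum>l = 1..m. real (m choose l) * ?T (l - 1)
      - real (m choose l) * real (m - l) / real l * ?T l)"
  proof (rule sum.cong[OF refl])
    fix l assume l: "l \<in> {1..m}"
    then have eq: "m - Suc (l - 1) = m - l" "m - l - 1 = m - Suc l" by simp_all
    have l': "1 \<le> l" "l \<le> m" using l by auto
    show "real (m choose l) / real l *
        (pochhammer (x + 1) l * pochhammer y (m - l) - pochhammer x l * pochhammer (y + 1) (m - l))
      = real (m choose l) * ?T (l - 1) - real (m choose l) * real (m - l) / real l * ?T l"
      unfolding eq pochhammer_exchange_diff[OF l'] using l' by (simp add: right_diff_distrib)
  qed
  also have "\<dots> = (\<Sum>l = 1..m. real (m choose l) * ?T (l - 1))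
      - (\<Sum>l = 1..m. real (m choose l) * real (m - l) / real l * ?T l)"
    by (rule sum_subtractf)
  also have "(\<Sum>l = 1..m. real (m choose l) * ?T (l - 1)) = (\<Sum>l<m. real (m choose Suc l) * ?T l)"
    by (rule sum.reindex_bij_witness[of _ Suc "\<lambda>l. l - 1"]) auto
  also have "\<dots> = real m * pochhammer (y + 1) (m - 1)
      + (\<Sum>l = 1..<m. real (m choose Suc l) * ?T l)"
    using Suc by (simp add: lessThan_atLeast0 sum.atLeast_Suc_lessThan)
  \<comment> \<open>The term at \<open>l = m\<close> drops out because of its factor
    \<open>m - l\<close>.\<close>
  also have "(\<Sum>l = 1..m. real (m choose l) * real (m - l) / real l * ?T l)
      = (\<Sum>l = 1..<m. real (m choose l) * real (m - l) / real l * ?T l)"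
    by (rule sum.mono_neutral_right) auto
  also have "\<dots> = (\<Sum>l = 1..<m. real (m choose Suc l) * ?T l
      + real (m choose Suc l) / real l * ?T l)"
    by (rule sum.cong) (simp_all only: binomial_divide_Suc distrib_right atLeastLessThan_iff)
  finally show ?thesis
    by (simp add: sum.distrib mult.assoc)
qed

text \<open>The right-hand side is that of \<open>corr_diff\<close> with \<open>x\<close> for
  \<open>x + 1\<close>. On the left, the rising factorials in \<open>y\<close> merge into one that
  is free of \<open>r\<close>, so that \<open>r\<close> remains only in
  \<open>r choose l\<close>.\<close>

lemma sum_pochhammer_gap:
  "(\<Sum>r<m. pochhammer (y + 1) (m - Suc r) * gap r x (y + real (m - r)))
    = real m * pochhammer (y + 1) (m - 1)
      - (\<Sum>l = 1..<m. real (m choose Suc l) / real l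
           * pochhammer x l * pochhammer (y + 1) (m - Suc l))"
proof -
  \<comment> \<open>The first product ends at the factor \<open>y + (m - r) - 1\<close>, just before
    the second one starts.\<close>
  have shift: "pochhammer (y + 1) (m - Suc r) * pochhammer (y + real (m - r)) (r - l)
      = pochhammer (y + 1) (m - Suc l)" if "l \<le> r" "r < m" for l r
    using that pochhammer_product[of "m - Suc r" "m - Suc l" "y + 1"]
    by (simp add: algebra_simps)
  have "pochhammer (y + 1) (m - Suc r) * gap r x (y + real (m - r))
    = pochhammer (y + 1) (m - 1)
      - (\<Sum>l = 1..<m. real (r choose l) / real l * pochhammer x l * pochhammer (y + 1) (m - Suc l))"
    if "r < m" for r
  proof -
    have "pochhammer (y + 1) (m - Suc r) * corr r x (y + real (m - r))
      = (\<Sum>l = 1..r. real (r choose l) / real l * pochhammer x l * pochhammer (y + 1) (m - Suc l))"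
      unfolding corr_def sum_distrib_left
      by (rule sum.cong) (auto simp: that shift[symmetric])
    \<comment> \<open>The added terms have \<open>l > r\<close>, hence
      \<open>r choose l = 0\<close>; a range free of \<open>r\<close> permits swapping the
      sums.\<close>
    also have "\<dots> = (\<Sum>l = 1..<m. real (r choose l) / real l * pochhammer x l
        * pochhammer (y + 1) (m - Suc l))"
      using that by (intro sum.mono_neutral_left) auto
    finally show ?thesis
      using shift[of 0 r] that by (simp add: gap_def right_diff_distrib)
  qed
  then have "(\<Sum>r<m. pochhammer (y + 1) (m - Suc r) * gap r x (y + real (m - r)))
    = real m * pochhammer (y + 1) (m - 1)
      - (\<Sum>r<m. \<Sum>l = 1..<m. real (r choose l) / real l * pochhammer x l
          * pochhammer (y + 1) (m - Suc l))"
    by (simp add: sum_subtractf)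
  also have "(\<Sum>r<m. \<Sum>l = 1..<m. real (r choose l) / real l * pochhammer x l
          * pochhammer (y + 1) (m - Suc l))
    = (\<Sum>l = 1..<m. real (\<Sum>r<m. r choose l) / real l * pochhammer x l
          * pochhammer (y + 1) (m - Suc l))"
    by (subst sum.swap) (simp add: sum_distrib_right sum_divide_distrib)
  also have "\<dots> = (\<Sum>l = 1..<m. real (m choose Suc l) / real l * pochhammer x l
          * pochhammer (y + 1) (m - Suc l))"
  proof (rule sum.cong[OF refl])
    fix l assume "l \<in> {1..<m}"
    then obtain p where "m = Suc p" by (cases m) auto
    then have "(\<Sum>r<m. r choose l) = (m choose Suc l)"
      using sum_choose_upper[of l p] by (simp add: lessThan_Suc_atMost atMost_atLeast0)
    then show "real (\<Sum>r<m. r choose l) / real l * pochhammer x l * pochhammer (y + 1) (m - Suc l)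
      = real (m choose Suc l) / real l * pochhammer x l * pochhammer (y + 1) (m - Suc l)"
      by simp
  qed
  finally show ?thesis .
qed

text \<open>For \<open>x = k - s'\<close> and \<open>y = s' + i\<close> the two \<open>corr\<close>
  terms belong to \<open>s'\<close> and \<open>s' + 1\<close>, which prepares the telescoping over
  \<open>s'\<close>.\<close>

lemma sum_pochhammer_gap_eq_corr_diff:
  assumes "i \<le> n"
  shows "(\<Sum>j\<in>{i<..n}. pochhammer (y + 1) (j - Suc i) * gap (n - j) (x + 1) (y + real (j - i)))
    = corr (n - i) (x + 1) y - corr (n - i) x (y + 1)"
proof -
  have "(\<Sum>j\<in>{i<..n}. pochhammer (y + 1) (j - Suc i) * gap (n - j) (x + 1) (y + real (j - i)))
    = (\<Sum>r<n - i. pochhammer (y + 1) (n - i - Suc r) * gap r (x + 1) (y + real (n - i - r)))"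
    by (rule sum.reindex_bij_witness[of _ "\<lambda>r. n - r" "\<lambda>j. n - j"]) auto
  then show ?thesis by (simp only: sum_pochhammer_gap corr_diff)
qed

section \<open>Closed form of the recursion without truncation\<close>

definition u_cand :: "nat \<Rightarrow> nat \<Rightarrow> nat \<Rightarrow> nat \<Rightarrow> real" where
  "u_cand n k i s = pochhammer (real s + 1) (i - 1)
    * gap (n - i) (real k - real s + 1) (real s + real i) / pochhammer (real k + 1) n"

lemma prod_shift_pochhammer:
  fixes x :: "'a::comm_semiring_1"
  shows "(\<Prod>t = 1..m. x + of_nat t) = pochhammer (x + 1) m"
  by (induction m) (simp_all add: pochhammer_Suc algebra_simps)

lemma prod_interval_pochhammer:
  fixes x :: "'a::comm_semiring_1"
  assumes "1 \<le> n"
  shows "(\<Prod>t = i..n - 1. x + of_nat t) = pochhammer (x + of_nat i) (n - i)"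
proof -
  have "(\<Prod>t = i..n - 1. x + of_nat t) = (\<Prod>t = 0..<n - i. x + of_nat i + of_nat t)"
    by (rule prod.reindex_bij_witness[of _ "\<lambda>t. i + t" "\<lambda>t. t - i"])
      (use assms in \<open>auto simp: add.assoc simp flip: of_nat_add\<close>)
  then show ?thesis by (simp add: pochhammer_prod)
qed

text \<open>The leading fraction supplies the missing factor \<open>t = 0\<close> of the
  denominator, which is why the denominator has length \<open>i\<close> and the numerator
  \<open>i - 1\<close>.\<close>

lemma inverse_prod_pochhammer:
  assumes "1 \<le> i"
  shows "1 / (real x + 1) * (\<Prod>t = 1..i - 1. (real s + real t) / (real x + real t + 1))
    = pochhammer (real s + 1) (i - 1) / pochhammer (real x + 1) i"
proof -
  have "(\<Prod>t = 1..i - 1. real x + real t + 1) = pochhammer (real x + 1 + 1) (i - 1)"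
    using prod_shift_pochhammer[of "real x + 1" "i - 1"] by (simp add: add.commute add.left_commute)
  moreover have "pochhammer (real x + 1) i = (real x + 1) * pochhammer (real x + 1 + 1) (i - 1)"
    using assms by (cases i) (simp_all add: pochhammer_rec)
  ultimately show ?thesis
    using prod_shift_pochhammer[of "real s" "i - 1"] by (simp add: prod_dividef)
qed

lemma dual_a_pochhammer:
  assumes "1 \<le> n"
  shows "dual_a n k i s = pochhammer (real s + 1) (n - 1) / pochhammer (real k + 1) n"
  unfolding dual_a_def using assms by (rule inverse_prod_pochhammer)

lemma dual_c_pochhammer:
  assumes "1 \<le> i" "s \<le> s'"
  shows "dual_c j s' i s = pochhammer (real s + 1) (i - 1) / pochhammer (real s' + 1) i"
  using assms inverse_prod_pochhammer[of i s' s] by (simp add: dual_c_def)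

lemma dual_c_nonneg: "0 \<le> dual_c j s' i s"
  by (auto simp: dual_c_def intro!: prod_nonneg divide_nonneg_nonneg)

text \<open>The denominator of \<open>dual_c\<close> cancels the first \<open>i\<close> factors of
  \<open>pochhammer (real s' + 1) (j - 1)\<close>; what is pulled out in front depends on neither
  \<open>j\<close> nor \<open>s'\<close>.\<close>

lemma u_cand_mult_dual_c:
  assumes "1 \<le> i" "i < j" "s \<le> s'"
  shows "u_cand n k j s' * dual_c j s' i s
    = pochhammer (real s + 1) (i - 1) / pochhammer (real k + 1) n
      * (pochhammer (real s' + real i + 1) (j - Suc i)
         * gap (n - j) (real k - real s' + 1) (real s' + real i + real (j - i)))"
proof -
  have "pochhammer (real s' + 1) (j - 1)
      = pochhammer (real s' + 1) i * pochhammer (real s' + real i + 1) (j - Suc i)"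
    using assms pochhammer_product[of i "j - 1" "real s' + 1"] by (simp add: algebra_simps)
  moreover have "pochhammer (real s' + 1) i > 0" by (simp add: pochhammer_pos)
  ultimately show ?thesis
    using assms by (simp add: u_cand_def dual_c_pochhammer)
qed

lemma u_cand_recursion:
  assumes "1 \<le> i" "i \<le> n" "s \<le> k"
  shows "u_cand n k i s
    = dual_a n k i s - (\<Sum>j\<in>{i<..n}. \<Sum>s'\<in>{s..k}. u_cand n k j s' * dual_c j s' i s)"
proof -
  let ?K = "pochhammer (real s + 1) (i - 1) / pochhammer (real k + 1) n"
  define R where "R s' = corr (n - i) (real k - real s' + 1) (real s' + real i)" for s'
  have "(\<Sum>j\<in>{i<..n}. \<Sum>s'\<in>{s..k}. u_cand n k j s' * dual_c j s' i s)
    = (\<Sum>j\<in>{i<..n}. \<Sum>s'\<in>{s..k}. ?K * (pochhammer (real s' + real i + 1) (j - Suc i)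
         * gap (n - j) (real k - real s' + 1) (real s' + real i + real (j - i))))"
    using assms by (intro sum.cong refl u_cand_mult_dual_c) auto
  also have "\<dots> = ?K * (\<Sum>s'\<in>{s..k}. \<Sum>j\<in>{i<..n}. pochhammer (real s' + real i + 1) (j - Suc i)
         * gap (n - j) (real k - real s' + 1) (real s' + real i + real (j - i)))"
    by (subst sum.swap) (simp only: sum_distrib_left)
  also have "\<dots> = ?K * (\<Sum>s'\<in>{s..k}. R s' - R (Suc s'))"
  proof -
    have "real k - real (Suc s') + 1 = real k - real s'" "real (Suc s') + real i = real s' + real i + 1"
      for s' by simp_all
    then show ?thesis
      using assms by (simp only: sum_pochhammer_gap_eq_corr_diff R_def)
  qed
  also have "(\<Sum>s'\<in>{s..k}. R s' - R (Suc s')) = R s - R (Suc k)"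
    using sum_Suc_diff[of s k "\<lambda>s'. - R s'"] assms by simp
  \<comment> \<open>Here the first argument of \<open>corr\<close> is
    \<open>k - (k + 1) + 1 = 0\<close>, and every summand has a rising factorial of 0 of positive
    length.\<close>
  also have "R (Suc k) = 0"
    by (auto simp: R_def corr_def pochhammer_0_left intro!: sum.neutral)
  finally have sum_eq: "(\<Sum>j\<in>{i<..n}. \<Sum>s'\<in>{s..k}. u_cand n k j s' * dual_c j s' i s) = ?K * R s"
    by simp
  have "pochhammer (real s + 1) (n - 1)
      = pochhammer (real s + 1) (i - 1) * pochhammer (real s + real i) (n - i)"
    using assms pochhammer_product[of "i - 1" "n - 1" "real s + 1"]
    by (simp add: algebra_simps)
  then show ?thesis
    unfolding sum_eq
    using assms by (simp add: u_cand_def gap_def R_def dual_a_pochhammer diff_divide_distrib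
        right_diff_distrib)
qed

section \<open>Monotonicity of the sign of the closed form\<close>

lemma gap_factor:
  assumes "y > 0"
  shows "gap m x y = pochhammer y m *
    (1 - (\<Sum>l = 1..m. real (m choose l) / real l * pochhammer x l / pochhammer (y + real (m - l)) l))"
proof -
  have "corr m x y = (\<Sum>l = 1..m. pochhammer y m *
      (real (m choose l) / real l * pochhammer x l / pochhammer (y + real (m - l)) l))"
    unfolding corr_def
  proof (rule sum.cong[OF refl])
    fix l assume "l \<in> {1..m}"
    then have "pochhammer y m = pochhammer y (m - l) * pochhammer (y + real (m - l)) l"
      using pochhammer_product[of "m - l" m y] by simp
    moreover have "pochhammer (y + real (m - l)) l > 0"
      using assms by (intro pochhammer_pos) simp
    ultimately show "real (m choose l) / real l * pochhammer x l * pochhammer y (m - l)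
      = pochhammer y m * (real (m choose l) / real l * pochhammer x l / pochhammer (y + real (m - l)) l)"
      by simp
  qed
  then show ?thesis by (simp add: gap_def right_diff_distrib sum_distrib_left)
qed

lemma pochhammer_mono:
  fixes x y :: "'a::linordered_semidom"
  assumes "0 \<le> x" "x \<le> y"
  shows "pochhammer x m \<le> pochhammer y m"
  unfolding pochhammer_prod using assms by (intro prod_mono) auto

lemma gap_pos_mono:
  assumes "1 \<le> i" "i \<le> j" "j \<le> n" "s \<le> s'" "s' \<le> k"
    and "gap (n - i) (real k - real s + 1) (real s + real i) > 0"
  shows "gap (n - j) (real k - real s' + 1) (real s' + real j) > 0"
proof -
  let ?h = "\<lambda>m s l. real (m choose l) / real l * pochhammer (real k - real s + 1) l
    / pochhammer (real s + real (n - l)) l"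
  \<comment> \<open>Since \<open>(s + i) + (n - i - l) = s + (n - l)\<close>, the denominators in
    \<open>?h\<close> are free of \<open>i\<close>; the position enters only through the binomial
    coefficient and the range of \<open>l\<close>.\<close>
  have gap_eq: "gap (n - i) (real k - real s + 1) (real s + real i)
      = pochhammer (real s + real i) (n - i) * (1 - (\<Sum>l = 1..n - i. ?h (n - i) s l))"
    if "1 \<le> i" "i \<le> n" for i s
  proof -
    have "(\<Sum>l = 1..n - i. real (n - i choose l) / real l * pochhammer (real k - real s + 1) l
        / pochhammer (real s + real i + real (n - i - l)) l) = (\<Sum>l = 1..n - i. ?h (n - i) s l)"
      by (rule sum.cong) (use that in auto)
    then show ?thesis using that by (simp add: gap_factor)
  qed
  have "(\<Sum>l = 1..n - j. ?h (n - j) s' l) \<le> (\<Sum>l = 1..n - j. ?h (n - i) s l)"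
  proof (rule sum_mono)
    fix l assume l: "l \<in> {1..n - j}"
    have "real (n - j choose l) \<le> real (n - i choose l)"
      using assms by (intro of_nat_mono binomial_right_mono) auto
    moreover have "0 \<le> pochhammer (real k - real s' + 1) l"
      using assms by (intro pochhammer_nonneg) auto
    moreover have "pochhammer (real k - real s' + 1) l \<le> pochhammer (real k - real s + 1) l"
      using assms by (intro pochhammer_mono) auto
    moreover have "0 < pochhammer (real s + real (n - l)) l"
      using assms l by (intro pochhammer_pos) auto
    moreover have "pochhammer (real s + real (n - l)) l \<le> pochhammer (real s' + real (n - l)) l"
      using assms by (intro pochhammer_mono) auto
    ultimately show "?h (n - j) s' l \<le> ?h (n - i) s l"
      by (intro frac_le mult_mono divide_right_mono) auto
  qed
  also have "\<dots> \<le> (\<Sum>l = 1..n - i. ?h (n - i) s l)"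
  proof (rule sum_mono2)
    show "{1..n - j} \<subseteq> {1..n - i}" using assms by auto
    show "0 \<le> ?h (n - i) s l" if "l \<in> {1..n - i} - {1..n - j}" for l
      using assms that
      by (intro divide_nonneg_nonneg mult_nonneg_nonneg less_imp_le[OF pochhammer_pos]) auto
  qed simp
  also have "\<dots> < 1"
    using assms gap_eq[of i s] pochhammer_pos[of "real s + real i" "n - i"]
    by (simp add: zero_less_mult_iff)
  finally show ?thesis
    using assms gap_eq[of j s'] pochhammer_pos[of "real s' + real j" "n - j"] by simp
qed

section \<open>Truncated recursion and return to products\<close>

lemma u_cand_pos_iff:
  "u_cand n k i s > 0 \<longleftrightarrow> gap (n - i) (real k - real s + 1) (real s + real i) > 0"
  using pochhammer_pos[of "real s + 1" "i - 1"] pochhammer_pos[of "real k + 1" n]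
  by (simp add: u_cand_def zero_less_mult_iff zero_less_divide_iff)

lemma dual_u_eq_max_u_cand:
  assumes "1 \<le> i" "i < n" "s \<le> k"
  shows "dual_u n k i s = max 0 (u_cand n k i s)"
  using assms
proof (induction "n - i" arbitrary: i s rule: less_induct)
  case less
  have last: "dual_u n k n s' = u_cand n k n s'" if "s' \<le> k" for s'
    using u_cand_recursion[of n n s' k] that less.prems by (simp add: dual_u.simps)
  \<comment> \<open>The recursion has no \<open>max\<close> at position \<open>n\<close>; positivity
    there lets \<open>IH\<close> take the same form for all later positions.\<close>
  have last_pos: "0 < u_cand n k n s'" for s'
    by (simp add: u_cand_pos_iff gap_def corr_def)
  have IH: "dual_u n k j s' = max 0 (u_cand n k j s')" if "i < j" "j \<le> n" "s' \<le> k" for j s'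
  proof (cases "j = n")
    case True
    then show ?thesis using last[of s'] last_pos[of s'] that by simp
  next
    case False
    then show ?thesis using less.hyps[of j s'] less.prems that by simp
  qed
  define Su where "Su = (\<Sum>j\<in>{i<..n}. \<Sum>s'\<in>{s..k}. dual_u n k j s' * dual_c j s' i s)"
  define Sc where "Sc = (\<Sum>j\<in>{i<..n}. \<Sum>s'\<in>{s..k}. u_cand n k j s' * dual_c j s' i s)"
  have u: "dual_u n k i s = max 0 (dual_a n k i s - Su)"
    using less.prems by (simp add: dual_u.simps[of n k i s] Su_def)
  have cand: "u_cand n k i s = dual_a n k i s - Sc"
    using less.prems u_cand_recursion[of i n s k] by (simp add: Sc_def)
  have "Sc \<le> Su"
    unfolding Sc_def Su_def by (intro sum_mono mult_right_mono dual_c_nonneg) (simp add: IH)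
  \<comment> \<open>By \<open>gap_pos_mono\<close>, positivity at \<open>(i, s)\<close> passes to
    every \<open>(j, s')\<close> in the sum, where the \<open>max\<close> is then inactive.\<close>
  moreover have "Su = Sc" if pos: "u_cand n k i s > 0"
    unfolding Sc_def Su_def
  proof (intro sum.cong refl)
    fix j s' assume "j \<in> {i<..n}" "s' \<in> {s..k}"
    then show "dual_u n k j s' * dual_c j s' i s = u_cand n k j s' * dual_c j s' i s"
      using pos less.prems gap_pos_mono[of i j n s s' k] IH[of j s']
      by (simp add: u_cand_pos_iff[symmetric] max_def)
  qed
  ultimately show ?case using u cand by (cases "u_cand n k i s > 0") auto
qed

text \<open>Splitting \<open>pochhammer (real k + 1) n\<close> after \<open>i\<close> factors gives
  the denominator of the outer product, with its leading \<open>k + 1\<close>, and the common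
  denominator inside the bracket.\<close>

lemma u_cand_eq:
  assumes "1 \<le> i" "i < n"
  shows "u_cand n k i s = 1 / (real k + 1) *
    (\<Prod>t = 1..i - 1. (real s + real t) / (real k + real t + 1)) *
    ((\<Prod>t = i..n - 1. (real s + real t) / (real k + real t + 1)) -
     (\<Sum>j = 1..n - i. real (n - i choose j) * (1 / real j) *
        (\<Prod>l = 1..j. real k - real s + real l) *
        (\<Prod>l = 1..n - i - j. real s + real i - 1 + real l)) /
     (\<Prod>t = i..n - 1. real k + real t + 1))"
proof -
  have den: "(\<Prod>t = i..n - 1. real k + real t + 1) = pochhammer (real k + 1 + real i) (n - i)"
    using assms prod_interval_pochhammer[of n "real k + 1" i]
    by (simp add: add.commute add.left_commute)
  have num: "(\<Prod>t = i..n - 1. real s + real t) = pochhammer (real s + real i) (n - i)"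
    using assms prod_interval_pochhammer[of n "real s" i] by simp
  have corr: "(\<Sum>j = 1..n - i. real (n - i choose j) * (1 / real j) *
        (\<Prod>l = 1..j. real k - real s + real l) *
        (\<Prod>l = 1..n - i - j. real s + real i - 1 + real l))
      = corr (n - i) (real k - real s + 1) (real s + real i)"
    using prod_shift_pochhammer[of "real k - real s"] prod_shift_pochhammer[of "real s + real i - 1"]
    by (simp add: corr_def)
  have "pochhammer (real k + 1) n = pochhammer (real k + 1) i * pochhammer (real k + 1 + real i) (n - i)"
    using assms pochhammer_product[of i n "real k + 1"] by simp
  then show ?thesis
    unfolding inverse_prod_pochhammer[OF assms(1)]
    unfolding prod_dividef den num corr
    by (simp add: u_cand_def gap_def diff_divide_distrib[symmetric])
qed

theorem theorem3:
  fixes n k :: nat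
  assumes "n \<ge> 1"
  shows "(\<forall>s\<in>{0..k}.
            dual_u n k n s =
              1 / (real k + 1) * (\<Prod>t = 1..n - 1. (real s + real t) / (real k + real t + 1))) \<and>
         (\<forall>i\<in>{1..<n}. \<forall>s\<in>{0..k}.
            dual_u n k i s =
              max 0
               (1 / (real k + 1) * (\<Prod>t = 1..i - 1. (real s + real t) / (real k + real t + 1)) *
                ((\<Prod>t = i..n - 1. (real s + real t) / (real k + real t + 1)) -
                 (\<Sum>j = 1..n - i. real (n - i choose j) * (1 / real j) *
                    (\<Prod>l = 1..j. real k - real s + real l) *
                    (\<Prod>l = 1..n - i - j. real s + real i - 1 + real l)) /
                 (\<Prod>t = i..n - 1. real k + real t + 1))))"
proof (intro conjI ballI)
  fix s assume "s \<in> {0..k}"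
  show "dual_u n k n s =
      1 / (real k + 1) * (\<Prod>t = 1..n - 1. (real s + real t) / (real k + real t + 1))"
    by (simp add: dual_u.simps dual_a_def)
next
  fix i s assume "i \<in> {1..<n}" "s \<in> {0..k}"
  then have "1 \<le> i" "i < n" "s \<le> k" by auto
  then show "dual_u n k i s =
      max 0
       (1 / (real k + 1) * (\<Prod>t = 1..i - 1. (real s + real t) / (real k + real t + 1)) *
        ((\<Prod>t = i..n - 1. (real s + real t) / (real k + real t + 1)) -
         (\<Sum>j = 1..n - i. real (n - i choose j) * (1 / real j) *
            (\<Prod>l = 1..j. real k - real s + real l) *
            (\<Prod>l = 1..n - i - j. real s + real i - 1 + real l)) /
         (\<Prod>t = i..n - 1. real k + real t + 1)))"
    by (simp only: dual_u_eq_max_u_cand u_cand_eq)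
qed

end
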